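(* Let $p\in\mathcal{H}_1$ be such that $$|zp'(z)|<\frac{\sin 1}{2}\approx 0.420\ldots\qquad(z\in\mathbb{D}).$$ Then $p(z)\prec\cosh\sqrt z$.
   Context: $\mathbb{D}=\{z\in\mathbb{C}:|z|<1\}$. $\mathcal{H}_1$ is the class of analytic functions on $\mathbb{D}$ of the form $p(z)=1+a_1z+a_2z^2+\cdots$. For analytic functions $f,g$ on $\mathbb{D}$, $f\prec g$ means that $f(z)=g(w(z))$ for some analytic $w:\mathbb{D}\to\mathbb{D}$ with $w(0)=0$. The function $\cosh\sqrt z$ denotes the analytic function $\sum_{n=0}^\infty z^n/(2n)!$. *)

theory Defs
  imports "HOL-Complex_Analysis.Complex_Analysis"
begin

abbreviation unit_disc :: "complex set" where
  "unit_disc \<equiv> ball 0 1"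

text \<open>The normalisation says that the Taylor expansion at \<open>0\<close> has constant term \<open>1\<close>.\<close>

definition class_H1 :: "(complex \<Rightarrow> complex) set" where
  "class_H1 = {p. p holomorphic_on unit_disc \<and> p 0 = 1}"

text \<open>Only the values of \<open>f\<close> on the unit disc matter; analyticity of \<open>f\<close> and \<open>g\<close> there is
  part of the relation.\<close>

definition subordinate :: "(complex \<Rightarrow> complex) \<Rightarrow> (complex \<Rightarrow> complex) \<Rightarrow> bool"
  (infix "\<prec>" 50) where
  "f \<prec> g \<longleftrightarrow> f holomorphic_on unit_disc \<and> g holomorphic_on unit_disc \<and>
     (\<exists>w. w holomorphic_on unit_disc \<and> w ` unit_disc \<subseteq> unit_disc \<and> w 0 = 0 \<and>
          (\<forall>z\<in>unit_disc. f z = g (w z)))"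

text \<open>The entire function \<open>cosh \<surd>z\<close>, given by its power series so that no branch of the
  square root has to be chosen.\<close>

definition cosh_sqrt :: "complex \<Rightarrow> complex" where
  "cosh_sqrt z = (\<Sum>n. z ^ n / fact (2 * n))"

end

theory Submission
  imports Defs
begin

text \<open>By the Schwarz lemma the hypothesis gives \<open>\<bar>p'\<bar> \<le> sin 1 / 2\<close>, so \<open>p\<close> maps the unit disc into
  the disc of radius \<open>sin 1 / 2\<close> about \<open>1\<close>. Since \<open>cosh \<surd>z - 1 = z/2 + R z\<close> with a small
  remainder \<open>R\<close>, the function \<open>cosh \<surd>z\<close> is injective on the closed unit disc and stays at distance
  at least \<open>7/16 > sin 1 / 2\<close> from \<open>1\<close> on the unit circle. Hence its image of the unit disc contains
  that smaller disc, and \<open>p\<close> can be composed with the holomorphic inverse.\<close>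

text \<open>This is the remainder \<open>R\<close>; the index is shifted by 2 so that the sum starts
  at the quadratic term.\<close>

definition cosh_sqrt_tail :: "complex \<Rightarrow> complex" where
  "cosh_sqrt_tail z = (\<Sum>n. z ^ (n + 2) / fact (2 * n + 4))"

lemma summable_cosh_sqrt: "summable (\<lambda>n. z ^ n / fact (2 * n) :: complex)"
proof (rule summable_comparison_test')
  show "summable (\<lambda>n. norm (z ^ n /\<^sub>R fact n))"
    by (rule summable_norm_exp)
  show "norm (z ^ n / fact (2 * n)) \<le> norm (z ^ n /\<^sub>R fact n)" for n
  proof -
    have "(fact n :: real) \<le> fact (2 * n)"
      by (rule fact_mono) simp
    then show ?thesis
      by (simp add: norm_divide norm_power divide_simps mult_left_mono)
  qed
qed

lemma summable_cosh_sqrt_tail: "summable (\<lambda>n. z ^ (n + 2) / fact (2 * n + 4) :: complex)"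
  using summable_ignore_initial_segment[OF summable_cosh_sqrt[of z], of 2]
  by (simp only: add_mult_distrib2) simp

lemma cosh_sqrt_eq: "cosh_sqrt z = 1 + z / 2 + cosh_sqrt_tail z"
  using suminf_split_initial_segment[OF summable_cosh_sqrt[of z], of 2]
  unfolding cosh_sqrt_def cosh_sqrt_tail_def add_mult_distrib2
  by (simp add: lessThan_nat_numeral fact_Suc[of "Suc 0"] add.commute del: fact_Suc power_Suc)

lemma cosh_sqrt_0: "cosh_sqrt 0 = 1"
  by (simp add: cosh_sqrt_eq cosh_sqrt_tail_def)

lemma holomorphic_cosh_sqrt: "cosh_sqrt holomorphic_on A"
proof (rule holomorphic_onI)
  fix z :: complex
  have "cosh_sqrt holomorphic_on ball 0 (norm z + 1)"
  proof (rule power_series_holomorphic)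
    show "(\<lambda>n. 1 / fact (2 * n) * (w - 0) ^ n) sums cosh_sqrt w" for w
      using summable_sums[OF summable_cosh_sqrt[of w]] by (simp add: cosh_sqrt_def)
  qed
  then have "cosh_sqrt field_differentiable at z"
    by (rule holomorphic_on_imp_differentiable_at) auto
  then show "cosh_sqrt field_differentiable at z within A"
    by (rule field_differentiable_at_within)
qed

text \<open>Raising \<open>n\<close> by one multiplies the factorial by two factors, one of them at
  least 3. This crude growth rate gives the tail a geometric majorant of ratio 1/3.\<close>

lemma fact_ge_mult_power3:
  assumes "m > 0"
  shows "fact m * 3 ^ n \<le> (fact (2 * n + m) :: real)"
proof (induction n)
  case (Suc n)
  define N where "N = 2 * n + m"
  have "3 \<le> real (N + 2) * real (N + 1)"
    using assms mult_mono[of 3 "real (N + 2)" 1 "real (N + 1)"] by (simp add: N_def)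
  then have "fact m * 3 ^ n * 3 \<le> fact N * (real (N + 2) * real (N + 1))"
    using Suc by (intro mult_mono) (auto simp: N_def)
  also have "\<dots> = fact (Suc (Suc N))"
    by (simp add: algebra_simps)
  also have "Suc (Suc N) = 2 * Suc n + m"
    by (simp add: N_def)
  finally show ?case
    by (simp only: power_Suc2 mult.assoc)
qed simp

lemma norm_suminf_le_third:
  fixes f :: "nat \<Rightarrow> complex"
  assumes "\<And>n. norm (f n) \<le> c * (1 / 3) ^ n"
  shows "norm (suminf f) \<le> 3 / 2 * c"
proof -
  have "(\<lambda>n. c * (1 / 3) ^ n) sums (c * (1 / (1 - 1 / 3)))"
    by (intro sums_mult geometric_sums) simp
  moreover have "norm (suminf f) \<le> (\<Sum>n. c * (1 / 3) ^ n)"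
    by (rule norm_suminf_le[OF assms]) (use calculation sums_summable in blast)
  ultimately show ?thesis
    by (simp add: sums_iff)
qed

lemma norm_cosh_sqrt_tail_le:
  assumes "norm z \<le> 1"
  shows "norm (cosh_sqrt_tail z) \<le> 1 / 16"
proof -
  \<comment> \<open>The constant 24 is 4!, from the quadratic term; summing gives 3/2 * 1/24 =
    1/16.\<close>
  have "norm (z ^ (n + 2) / fact (2 * n + 4)) \<le> 1 / 24 * (1 / 3) ^ n" for n
  proof -
    have "24 * 3 ^ n \<le> (fact (2 * n + 4) :: real)"
      using fact_ge_mult_power3[of 4 n] by (simp add: fact_numeral)
    moreover have "norm z ^ (n + 2) \<le> 1"
      using assms by (intro power_le_one) auto
    ultimately have "norm z ^ (n + 2) / fact (2 * n + 4) \<le> 1 / (24 * 3 ^ n)"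
      by (intro frac_le) auto
    then show ?thesis
      by (simp add: norm_divide norm_mult norm_power power_divide del: power_Suc)
  qed
  from norm_suminf_le_third[OF this] show ?thesis
    by (simp add: cosh_sqrt_tail_def)
qed

text \<open>Termwise, powers with exponent \<open>k\<close> are \<open>k\<close>-Lipschitz on the
  closed unit disc, and the factorial absorbs \<open>k\<close>. The constant is 3/2 * 1/12; what
  matters is that it stays below the slope 1/2 of the linear term.\<close>

lemma cosh_sqrt_tail_lipschitz:
  assumes "norm z \<le> 1" "norm w \<le> 1"
  shows "norm (cosh_sqrt_tail z - cosh_sqrt_tail w) \<le> norm (z - w) / 8"
proof -
  have "norm (z ^ (n + 2) / fact (2 * n + 4) - w ^ (n + 2) / fact (2 * n + 4))
      \<le> norm (z - w) / 12 * (1 / 3) ^ n" for n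
  proof -
    have "6 * 3 ^ n \<le> (fact (2 * n + 3) :: real)"
      using fact_ge_mult_power3[of 3 n] by (simp add: fact_numeral)
    then have le: "norm (z - w) / (2 * fact (2 * n + 3)) \<le> norm (z - w) / (2 * (6 * 3 ^ n))"
      by (intro frac_le) auto
    \<comment> \<open>The last factor 2n + 4 is twice the Lipschitz constant n + 2, which therefore
      cancels.\<close>
    have "(fact (2 * n + 4) :: real) = real (n + 2) * (2 * fact (2 * n + 3))"
    proof -
      have "2 * n + 4 = Suc (2 * n + 3)" by simp
      then show ?thesis
        by (simp only: fact_Suc) (simp add: algebra_simps)
    qed
    then have "real (n + 2) * norm (z - w) / fact (2 * n + 4) = norm (z - w) / (2 * fact (2 * n + 3))"
      by (simp only:) (rule mult_divide_mult_cancel_left, simp)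
    moreover have "norm (z ^ (n + 2) - w ^ (n + 2)) / fact (2 * n + 4)
        \<le> real (n + 2) * norm (z - w) / fact (2 * n + 4)"
      by (intro divide_right_mono norm_power_diff assms) simp
    ultimately have "norm (z ^ (n + 2) - w ^ (n + 2)) / fact (2 * n + 4)
        \<le> norm (z - w) / (2 * (6 * 3 ^ n))"
      using le by linarith
    then show ?thesis
      by (simp add: norm_divide power_divide flip: diff_divide_distrib del: power_Suc fact_Suc)
  qed
  note * = norm_suminf_le_third[OF this]
  have "cosh_sqrt_tail z - cosh_sqrt_tail w =
      (\<Sum>n. z ^ (n + 2) / fact (2 * n + 4) - w ^ (n + 2) / fact (2 * n + 4))"
    unfolding cosh_sqrt_tail_def by (intro suminf_diff summable_cosh_sqrt_tail)
  with * show ?thesis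
    by simp
qed

text \<open>If two values agree, the tails must compensate the linear terms, so |z - w|/2 is at most
  |z - w|/8.\<close>

lemma inj_on_cosh_sqrt: "inj_on cosh_sqrt (cball 0 1)"
proof (rule inj_onI)
  fix z w :: complex
  assume "z \<in> cball 0 1" "w \<in> cball 0 1" and eq: "cosh_sqrt z = cosh_sqrt w"
  then have "norm (cosh_sqrt_tail z - cosh_sqrt_tail w) \<le> norm (z - w) / 8"
    by (intro cosh_sqrt_tail_lipschitz) auto
  moreover have "cosh_sqrt_tail z - cosh_sqrt_tail w = - ((z - w) / 2)"
  proof -
    have "cosh_sqrt_tail v = cosh_sqrt v - 1 - v / 2" for v
      by (simp add: cosh_sqrt_eq)
    then show ?thesis
      by (simp add: eq diff_divide_distrib)
  qed
  ultimately show "z = w"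
    by (simp add: norm_divide)
qed

text \<open>Since 1 < pi/3, the value is at most sqrt 3 / 2. The bound is twice the covering radius
  7/16.\<close>

lemma sin_1_less: "sin (1::real) < 7 / 8"
proof -
  have "sin (1::real) \<le> sin (pi / 3)"
    using pi_gt3 by (intro sin_monotone_2pi_le) auto
  moreover have "sqrt 3 < 7 / 4"
    by (rule real_less_lsqrt) (auto simp: power2_eq_square)
  ultimately show ?thesis
    by (simp add: sin_60)
qed

text \<open>An open map whose boundary values keep distance \<open>r\<close> from the image of the
  centre covers the ball of radius \<open>r\<close> about that image. Here \<open>r\<close> is 1/2 -
  1/16 = 7/16.\<close>

lemma ball_subset_cosh_sqrt_image: "ball 1 (sin 1 / 2) \<subseteq> cosh_sqrt ` unit_disc"
proof -
  have "ball (cosh_sqrt 0) (7 / 16) \<subseteq> cosh_sqrt ` unit_disc"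
  proof (rule ball_subset_open_map_image)
    show "continuous_on (closure unit_disc) cosh_sqrt"
      by (intro holomorphic_on_imp_continuous_on holomorphic_cosh_sqrt)
    have "open (cosh_sqrt ` unit_disc)"
      by (rule open_mapping_thm3[OF holomorphic_cosh_sqrt])
        (auto intro: inj_on_subset[OF inj_on_cosh_sqrt])
    then show "open (cosh_sqrt ` interior unit_disc)"
      by (simp add: interior_open)
    show "7 / 16 \<le> norm (cosh_sqrt z - cosh_sqrt 0)" if "z \<in> frontier unit_disc" for z
    proof -
      have z: "norm z = 1" using that by simp
      have "norm (z / 2) - norm (- cosh_sqrt_tail z) \<le> norm (z / 2 - - cosh_sqrt_tail z)"
        by (rule norm_triangle_ineq2)
      with norm_cosh_sqrt_tail_le[of z] z show ?thesis
        unfolding cosh_sqrt_0 by (simp add: cosh_sqrt_eq norm_divide)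
    qed
  qed auto
  with sin_1_less show ?thesis
    by (auto simp: cosh_sqrt_0)
qed

lemma norm_deriv_le_of_norm_mult_deriv_less:
  assumes holo: "p holomorphic_on unit_disc"
    and less: "\<And>z. z \<in> unit_disc \<Longrightarrow> cmod (z * deriv p z) < M"
    and z: "z \<in> unit_disc"
  shows "cmod (deriv p z) \<le> M"
proof -
  have M: "0 < M" using less[of 0] by simp
  define g where "g z = z * deriv p z / of_real M" for z
  have holo': "deriv p holomorphic_on unit_disc"
    by (intro holomorphic_deriv holo) simp
  have "g holomorphic_on unit_disc"
    unfolding g_def using M by (intro holomorphic_intros holo') auto
  moreover have "cmod (g z) < 1" if "cmod z < 1" for z
    using less[of z] M that by (simp add: g_def norm_divide)
  moreover have "g 0 = 0" by (simp add: g_def)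
  ultimately have le: "cmod (g z) \<le> cmod z" and le0: "cmod (deriv g 0) \<le> 1"
    using z by (intro Schwarz_Lemma(1,2)[of g z]; simp)+
  show ?thesis
  proof (cases "z = 0")
    case False
    with le M show ?thesis
      by (simp add: g_def norm_divide norm_mult divide_simps)
  next
    \<comment> \<open>At the origin the bound |g z| <= |z| is void; the derivative part of the
      Schwarz lemma replaces it, as g'(0) = p'(0)/M.\<close>
    case True
    have "deriv p field_differentiable at 0"
      by (rule holomorphic_on_imp_differentiable_at[OF holo']) auto
    then have "(deriv p has_field_derivative deriv (deriv p) 0) (at 0)"
      by (simp add: DERIV_deriv_iff_field_differentiable)
    then have "(g has_field_derivative deriv p 0 / of_real M) (at 0)"
      unfolding g_def using M by (auto intro!: derivative_eq_intros)
    with le0 True M show ?thesis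
      by (simp add: DERIV_imp_deriv norm_divide)
  qed
qed

theorem theorem4p5:
  fixes p :: "complex \<Rightarrow> complex"
  assumes "p \<in> class_H1"
    and "\<And>z. z \<in> unit_disc \<Longrightarrow> cmod (z * deriv p z) < sin 1 / 2"
  shows "p \<prec> cosh_sqrt"
proof -
  have holo: "p holomorphic_on unit_disc" and p0: "p 0 = 1"
    using assms(1) by (auto simp: class_H1_def)
  have "p z \<in> ball 1 (sin 1 / 2)" if z: "z \<in> unit_disc" for z
  proof -
    have "cmod (p z - p 0) \<le> sin 1 / 2 * cmod (z - 0)"
    proof (rule field_differentiable_bound[of unit_disc p "deriv p"])
      show "(p has_field_derivative deriv p w) (at w within unit_disc)" if "w \<in> unit_disc" for w
        by (rule has_field_derivative_at_within[OF holomorphic_derivI[OF holo open_ball that]])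
    qed (use z norm_deriv_le_of_norm_mult_deriv_less[OF holo assms(2)] in auto)
    \<comment> \<open>The hypothesis at 0 supplies \<open>0 < sin 1 / 2\<close>, so |z| < 1 makes
      the bound strict.\<close>
    also have "\<dots> < sin 1 / 2"
      using z assms(2)[of 0] by simp
    finally show ?thesis
      by (simp add: p0 dist_norm norm_minus_commute)
  qed
  then have image: "p ` unit_disc \<subseteq> cosh_sqrt ` unit_disc"
    using ball_subset_cosh_sqrt_image by blast
  have "inj_on cosh_sqrt unit_disc"
    by (rule inj_on_subset[OF inj_on_cosh_sqrt]) auto
  then obtain h where h: "h holomorphic_on cosh_sqrt ` unit_disc"
      "\<And>z. z \<in> unit_disc \<Longrightarrow> h (cosh_sqrt z) = z"
    using holomorphic_has_inverse[OF holomorphic_cosh_sqrt open_ball] by metis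
  \<comment> \<open>The inverse \<open>h\<close> composed with \<open>p\<close> is the required
    Schwarz function \<open>w\<close>.\<close>
  have "(h \<circ> p) holomorphic_on unit_disc"
    by (rule holomorphic_on_compose_gen[OF holo h(1) image])
  moreover have "(h \<circ> p) z \<in> unit_disc \<and> p z = cosh_sqrt ((h \<circ> p) z)" if "z \<in> unit_disc" for z
    using image h(2) that by fastforce
  moreover have "(h \<circ> p) 0 = 0"
    using h(2)[of 0] by (simp add: p0 cosh_sqrt_0)
  ultimately show ?thesis
    unfolding subordinate_def using holo holomorphic_cosh_sqrt by blast
qed

end
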